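(* Consider a Gaussian AR(1) system with gain $|a|<1$, in steady state. Alice uses the threshold controller, and Willie observes the system's output $(X_1,\dots,X_N)$ through a clean (noiseless) channel. Let $\mathcal{H}_0$ be the hypothesis that the system is uncontrolled, and $\mathcal{H}_1$ the hypothesis that the system is controlled by resetting at one time sample $1\le\tau\le N$, i.e., $X_{\tau+1}=Z_{\tau+1}$. Then for every $\varepsilon>0$ such that $$|a|\le\sqrt{1-2^{-4\varepsilon^2}},$$ and for any method of detection that Willie uses, Alice achieves $\varepsilon$-covertness.
   Context: A Gaussian AR(1) system with gain $a$ is $X_n=aX_{n-1}+Z_n-U_n$ with $Z_n\sim\mathcal{N}(0,\sigma_Z^2)$ i.i.d., $\sigma_Z>0$, where $U_n$ is the control signal ($U_n=0$ when uncontrolled). In steady state, the uncontrolled vector $(X_1,\dots,X_N)$ is $\mathcal{N}(0,\Sigma)$ with $[\Sigma]_{ij}=\frac{\sigma_Z^2}{1-a^2}a^{|i-j|}$. The threshold controller with threshold $D>0$ is $U_n=aX_{n-1}$ if $|X_{n-1}|\ge D$ and $U_n=0$ if $|X_{n-1}|<D$; thus a control action following a crossing at time $\tau$ replaces $X_{\tau+1}$ by $Z_{\tau+1}$. With a single control action, the controlled process is modelled as follows: the time $\tau\in\{1,\dots,N\}$ has an arbitrary distribution (unknown to Willie), and conditionally on $\tau=\tau_1$ the process is the Gaussian process which starts in steady state and evolves as $X_n=aX_{n-1}+Z_n$ for $n\ne\tau_1+1$ and $X_{\tau_1+1}=Z_{\tau_1+1}$, with the noise still i.i.d. $\mathcal{N}(0,\sigma_Z^2)$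 (conditioning on $\tau$ is taken not to alter the noise law). For a test, $\alpha$ is the false alarm probability (deciding $\mathcal{H}_1$ when $\mathcal{H}_0$ is true) and $\beta$ the miss detection probability (deciding $\mathcal{H}_0$ when $\mathcal{H}_1$ is true). Alice achieves $\varepsilon$-covertness if $\alpha+\beta\ge1-\varepsilon$. *)

theory Defs
  imports "HOL-Probability.Probability"
begin

(* The control signal of a controller that acts after the times k in C:
   U_{k+1} = a X_k for k in C, so that X_{k+1} = Z_{k+1}, and no control at all other times. *)
definition reset_control :: "real \<Rightarrow> nat set \<Rightarrow> (nat \<Rightarrow> real) \<Rightarrow> nat \<Rightarrow> real" where
  "reset_control a C x n = (if n - 1 \<in> C then a * x (n - 1) else 0)"

(* The control signals used in the two hypotheses are reset_control with C = {} (uncontrolled) and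
   C = {\<tau>} (one action); the threshold controller has the level crossings as action times. *)
definition threshold_control :: "real \<Rightarrow> real \<Rightarrow> (nat \<Rightarrow> real) \<Rightarrow> nat \<Rightarrow> real" where
  "threshold_control a D x n = (if D \<le> \<bar>x (n - 1)\<bar> then a * x (n - 1) else 0)"

lemma threshold_control_eq_reset_control:
  "threshold_control a D x = reset_control a {k. D \<le> \<bar>x k\<bar>} x"
  by (auto simp: threshold_control_def reset_control_def)

(* Time starts at 1. X 1 has the stationary law N(0, v), where v = \<sigma>^2 / (1 - a^2) is the solution
   of v = a^2 v + \<sigma>^2, and is independent of the noise Z 2, Z 3, ... driving the later samples;
   X 0 and Z 1 are irrelevant. The second argument of normal_density is the standard deviation.
   The recursion is only required almost everywhere: the predicate is also applied to conditional
   measures, which have the same underlying space. *)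
locale steady_ar1 = prob_space M
  for M :: "'w measure" and a \<sigma> :: real and X Z U :: "nat \<Rightarrow> 'w \<Rightarrow> real" +
  assumes measurable_X: "\<And>n. n \<ge> 1 \<Longrightarrow> X n \<in> borel_measurable M"
    and initial: "distributed M lborel (X 1) (normal_density 0 (\<sigma> / sqrt (1 - a\<^sup>2)))"
    and noise: "\<And>n. n \<ge> 2 \<Longrightarrow> distributed M lborel (Z n) (normal_density 0 \<sigma>)"
    and independent: "indep_vars (\<lambda>_. borel) (\<lambda>n. if n = 1 then X 1 else Z n) {1..}"
    and evolution: "\<And>n. n \<ge> 2 \<Longrightarrow> AE \<omega> in M. X n \<omega> = a * X (n - 1) \<omega> + Z n \<omega> - U n \<omega>"

definition uncontrolled_ar1 ::
  "'w measure \<Rightarrow> real \<Rightarrow> real \<Rightarrow> (nat \<Rightarrow> 'w \<Rightarrow> real) \<Rightarrow> (nat \<Rightarrow> 'w \<Rightarrow> real) \<Rightarrow> bool" where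
  "uncontrolled_ar1 M a \<sigma> X Z \<longleftrightarrow> steady_ar1 M a \<sigma> X Z (\<lambda>n \<omega>. reset_control a {} (\<lambda>k. X k \<omega>) n)"

(* One control action at a random time \<tau> of arbitrary distribution on {1..N}; conditionally on
   \<tau> = t (whenever this event has positive probability) the process starts in steady state, the
   noise has its original law, and X (t + 1) = Z (t + 1). *)
definition single_reset_ar1 ::
  "'w measure \<Rightarrow> real \<Rightarrow> real \<Rightarrow> nat \<Rightarrow> ('w \<Rightarrow> nat) \<Rightarrow> (nat \<Rightarrow> 'w \<Rightarrow> real) \<Rightarrow> (nat \<Rightarrow> 'w \<Rightarrow> real) \<Rightarrow> bool" where
  "single_reset_ar1 M a \<sigma> N \<tau> X Z \<longleftrightarrow>
     prob_space M \<and> \<tau> \<in> M \<rightarrow>\<^sub>M count_space UNIV \<and> (AE \<omega> in M. \<tau> \<omega> \<in> {1..N}) \<and>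
     (\<forall>t\<in>{1..N}. measure M {\<omega> \<in> space M. \<tau> \<omega> = t} > 0 \<longrightarrow>
        steady_ar1 (uniform_measure M {\<omega> \<in> space M. \<tau> \<omega> = t}) a \<sigma> X Z
          (\<lambda>n \<omega>. reset_control a {t} (\<lambda>k. X k \<omega>) n))"

definition obs_space :: "nat \<Rightarrow> (nat \<Rightarrow> real) measure" where
  "obs_space N = Pi\<^sub>M {1..N} (\<lambda>_. borel)"

definition obs_law :: "'w measure \<Rightarrow> nat \<Rightarrow> (nat \<Rightarrow> 'w \<Rightarrow> real) \<Rightarrow> (nat \<Rightarrow> real) measure" where
  "obs_law M N X = distr M (obs_space N) (\<lambda>\<omega>. \<lambda>n\<in>{1..N}. X n \<omega>)"

datatype hypothesis = H0 | H1

(* A detector is an arbitrary, possibly randomized, decision rule: a Markov kernel from the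
   observations to the decisions. Deterministic rules d are x \<mapsto> return (count_space UNIV) (d x). *)
definition detector :: "nat \<Rightarrow> ((nat \<Rightarrow> real) \<Rightarrow> hypothesis measure) \<Rightarrow> bool" where
  "detector N \<delta> \<longleftrightarrow> \<delta> \<in> obs_space N \<rightarrow>\<^sub>M prob_algebra (count_space UNIV)"

definition false_alarm ::
  "(nat \<Rightarrow> real) measure \<Rightarrow> ((nat \<Rightarrow> real) \<Rightarrow> hypothesis measure) \<Rightarrow> real" where
  "false_alarm P0 \<delta> = measure (P0 \<bind> \<delta>) {H1}"

definition miss_detection ::
  "(nat \<Rightarrow> real) measure \<Rightarrow> ((nat \<Rightarrow> real) \<Rightarrow> hypothesis measure) \<Rightarrow> real" where
  "miss_detection P1 \<delta> = measure (P1 \<bind> \<delta>) {H0}"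

definition covert ::
  "real \<Rightarrow> (nat \<Rightarrow> real) measure \<Rightarrow> (nat \<Rightarrow> real) measure \<Rightarrow>
     ((nat \<Rightarrow> real) \<Rightarrow> hypothesis measure) \<Rightarrow> bool" where
  "covert \<epsilon> P0 P1 \<delta> \<longleftrightarrow> false_alarm P0 \<delta> + miss_detection P1 \<delta> \<ge> 1 - \<epsilon>"

end

theory Submission
  imports Defs
begin

text \<open>
  Conditionally on the time t of the control action, the observations under both hypotheses are
  deterministic functions of the same independent Gaussian innovations: the initial state and the
  driving noise. Resetting at time t removes the summand a X_t from X_{t+1}. Equivalently, the
  uncontrolled path is the reset path driven by innovations in which Z_{t+1} has been replaced by
  Z_{t+1} + a X_t (\<open>ar1_path_reset_eq_shift\<close>). Since X_t is a function of the earlier innovations,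
  the two hypotheses differ by a shift of one N(0, \<sigma>^2) coordinate by an independent amount a X_t,
  and stationarity gives X_t the law N(0, \<sigma>^2 / (1 - a^2)) (\<open>ar1_path_stationary\<close>).

  The total variation between two laws is at most sqrt (1 - B^2), where B is their Bhattacharyya
  coefficient (\<open>test_gap_le_hellinger\<close>). For the random Gaussian shift B has a closed form
  (\<open>random_shift_test_gap\<close>), and here 1 - B^2 = a^2 / (4 - 3 a^2). This is at most
  - log 2 (1 - a^2) / 4, which the hypothesis on the gain bounds by \<epsilon>^2 (\<open>reset_gain_bound\<close>).
  Using the Bhattacharyya coefficient rather than relative entropy matters: the relative entropy
  is a^2 / (2 (1 - a^2)), and Pinsker's inequality then gives the bound \<epsilon> only for a^2 at most 1/2.

  The bound is the same for every t. Under the controlled hypothesis the expectation of a test is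
  an average of its conditional expectations given \<tau> = t, so the bound survives an arbitrary
  distribution of \<tau>. A randomized detector is represented by its probability of deciding H1, a
  test function with values in [0, 1].
\<close>

section \<open>The numerical inequality\<close>

text \<open>
  With y = 1 - s the claim is 4 ln 2 (1 - y) / (1 + 3 y) \<le> - ln y. Both sides vanish at y = 1, and
  the right side minus the left side is nonincreasing in y because 16 y ln 2 \<le> 12 y \<le> (1 + 3 y)^2.
\<close>
lemma reset_gain_bound:
  fixes s :: real
  assumes "0 \<le> s" "s < 1"
  shows "s / (4 - 3 * s) \<le> - log 2 (1 - s) / 4"
proof -
  let ?f = "\<lambda>y::real. - ln y - 4 * ln 2 * (1 - y) / (1 + 3 * y)"
  have "?f 1 \<le> ?f (1 - s)"
  proof (rule DERIV_nonpos_imp_nonincreasing[of "1 - s" 1 ?f])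
    fix y assume y: "1 - s \<le> y" "y \<le> 1"
    then have [simp]: "y > 0" using assms by simp
    have "ln 2 \<le> (3/4 :: real)" using ln2_le_25_over_36 by simp
    then have "16 * ln 2 * y \<le> 12 * y" by simp
    also have "\<dots> = (1 + 3 * y)\<^sup>2 - (1 - 3 * y)\<^sup>2" by (simp add: power2_eq_square algebra_simps)
    also have "\<dots> \<le> (1 + 3 * y)\<^sup>2" by simp
    finally have "16 * ln 2 \<le> 1 / y * (1 + 3 * y)\<^sup>2"
      by (simp add: pos_le_divide_eq)
    moreover have "0 < (1 + 3 * y)\<^sup>2" using \<open>y > 0\<close> by (intro zero_less_power add_pos_pos) auto
    ultimately have "16 * ln 2 / (1 + 3 * y)\<^sup>2 \<le> 1 / y"
      by (simp only: pos_divide_le_eq)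
    moreover have "(?f has_real_derivative - (1 / y) + 16 * ln 2 / (1 + 3 * y)\<^sup>2) (at y)"
      using \<open>0 < (1 + 3 * y)\<^sup>2\<close>
      by (auto intro!: derivative_eq_intros simp: power2_eq_square) (simp add: field_simps)
    ultimately show "\<exists>d. (?f has_real_derivative d) (at y) \<and> d \<le> 0"
      by (intro exI conjI) auto
  qed (use assms in simp)
  then have "4 * ln 2 * s / (4 - 3 * s) \<le> - ln (1 - s)" by (simp add: algebra_simps)
  then have "(4 * ln 2 * s / (4 - 3 * s)) / (4 * ln 2) \<le> - ln (1 - s) / (4 * ln 2)"
    by (intro divide_right_mono) auto
  then show ?thesis by (simp add: log_def mult.commute)
qed

text \<open>Squaring and taking logarithms turns the gain condition into - log 2 (1 - a^2) / 4 \<le> \<epsilon>^2.\<close>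
lemma covert_gain_bound:
  fixes a \<epsilon> :: real
  assumes "\<bar>a\<bar> < 1" "\<epsilon> > 0" and gain: "\<bar>a\<bar> \<le> sqrt (1 - 2 powr (- 4 * \<epsilon>\<^sup>2))"
  shows "sqrt (a\<^sup>2 / (4 - 3 * a\<^sup>2)) \<le> \<epsilon>"
proof -
  have a1: "a\<^sup>2 < 1" using assms(1) by (simp add: abs_square_less_1)
  have "0 \<le> \<bar>a\<bar>" by simp
  then have "0 \<le> sqrt (1 - 2 powr (- 4 * \<epsilon>\<^sup>2))" using gain by linarith
  then have "a\<^sup>2 \<le> 1 - 2 powr (- 4 * \<epsilon>\<^sup>2)"
    using power_mono[OF gain, of 2] by simp
  then have "log 2 (2 powr (- 4 * \<epsilon>\<^sup>2)) \<le> log 2 (1 - a\<^sup>2)"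
    using a1 by (subst log_le_cancel_iff) auto
  then have "- log 2 (1 - a\<^sup>2) / 4 \<le> \<epsilon>\<^sup>2" by simp
  with reset_gain_bound[of "a\<^sup>2"] a1 have "a\<^sup>2 / (4 - 3 * a\<^sup>2) \<le> \<epsilon>\<^sup>2"
    by simp
  then show ?thesis
    using assms(2) by (intro real_le_lsqrt) auto
qed

section \<open>Tests and the Bhattacharyya coefficient\<close>

text \<open>
  The function r is the density of a second probability law with respect to M, and \<psi> is a test.
  The gap between the two expectations of \<psi> is E[(1 - r) (\<psi> - 1/2)] \<le> E|1 - r| / 2, as 1 - r has
  mean zero. Factoring |1 - r| = |1 - sqrt r| (1 + sqrt r), the Cauchy-Schwarz inequality bounds
  (E|1 - r|)^2 by (2 - 2 B) (2 + 2 B), where B = E (sqrt r).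
\<close>
lemma (in prob_space) test_gap_le_hellinger:
  fixes r \<psi> :: "'a \<Rightarrow> real"
  assumes [measurable]: "r \<in> borel_measurable M" "\<psi> \<in> borel_measurable M"
    and r: "\<And>x. 0 \<le> r x" "integrable M r" "expectation r = 1"
    and \<psi>: "\<And>x. x \<in> space M \<Longrightarrow> 0 \<le> \<psi> x \<and> \<psi> x \<le> 1"
  shows "expectation \<psi> - expectation (\<lambda>x. r x * \<psi> x) \<le> sqrt (1 - (expectation (\<lambda>x. sqrt (r x)))\<^sup>2)"
proof -
  let ?B = "expectation (\<lambda>x. sqrt (r x))"
  have iq: "integrable M (\<lambda>x. sqrt (r x))"
  proof (rule Bochner_Integration.integrable_bound)
    show "integrable M (\<lambda>x. 1 + r x)" using r by simp
    have "sqrt (r x) \<le> 1 + r x" for x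
      using r(1)[of x] by (intro real_le_lsqrt) (auto simp: power2_eq_square algebra_simps)
    then show "AE x in M. norm (sqrt (r x)) \<le> norm (1 + r x)" using r(1) by simp
  qed simp
  have iab: "integrable M (\<lambda>x. \<bar>1 - r x\<bar>)" using r by simp
  have ip: "integrable M (\<lambda>x. (1 + sqrt (r x))\<^sup>2)" and im: "integrable M (\<lambda>x. (1 - sqrt (r x))\<^sup>2)"
    using r iq by (simp_all add: power2_sum power2_diff)
  have ep: "expectation (\<lambda>x. (1 + sqrt (r x))\<^sup>2) = 2 + 2 * ?B"
    and em: "expectation (\<lambda>x. (1 - sqrt (r x))\<^sup>2) = 2 - 2 * ?B"
    using r iq by (simp_all add: power2_sum power2_diff prob_space)
  have ip\<psi>: "integrable M \<psi>"
    by (rule Bochner_Integration.integrable_bound[of M "\<lambda>_. 1::real"]) (use \<psi> in auto)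
  have ir\<psi>: "integrable M (\<lambda>x. r x * \<psi> x)"
  proof (rule Bochner_Integration.integrable_bound[OF r(2)])
    show "AE x in M. norm (r x * \<psi> x) \<le> norm (r x)"
      using \<psi> r(1) by (intro AE_I2) (simp add: abs_mult mult_left_le)
  qed simp
  have "expectation \<psi> - expectation (\<lambda>x. r x * \<psi> x) = expectation (\<lambda>x. (1 - r x) * (\<psi> x - 1/2))"
    using r(2,3) ip\<psi> ir\<psi> by (simp add: algebra_simps prob_space)
  also have "\<dots> \<le> expectation (\<lambda>x. \<bar>1 - r x\<bar> / 2)"
  proof (rule integral_mono)
    show "integrable M (\<lambda>x. (1 - r x) * (\<psi> x - 1 / 2))"
      using r(2) ip\<psi> ir\<psi> by (simp add: algebra_simps)
    show "integrable M (\<lambda>x. \<bar>1 - r x\<bar> / 2)" using iab by simp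
    fix x assume x: "x \<in> space M"
    have "(1 - r x) * (\<psi> x - 1 / 2) \<le> \<bar>1 - r x\<bar> * \<bar>\<psi> x - 1 / 2\<bar>"
      by (metis abs_ge_self abs_mult)
    also have "\<dots> \<le> \<bar>1 - r x\<bar> * (1/2)"
      using \<psi>[OF x] by (intro mult_left_mono) (auto simp: abs_if)
    finally show "(1 - r x) * (\<psi> x - 1 / 2) \<le> \<bar>1 - r x\<bar> / 2" by simp
  qed
  also have "\<dots> = expectation (\<lambda>x. \<bar>1 - r x\<bar>) / 2" by simp
  also have "\<dots> \<le> sqrt (1 - ?B\<^sup>2)"
  proof -
    let ?E = "expectation (\<lambda>x. \<bar>1 - r x\<bar>)"
    have fac: "ennreal \<bar>1 - r x\<bar> = ennreal \<bar>1 - sqrt (r x)\<bar> * ennreal (1 + sqrt (r x))" for x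
    proof -
      have "1 - r x = (1 - sqrt (r x)) * (1 + sqrt (r x))" using r(1)[of x] by (simp add: algebra_simps)
      then show ?thesis using r(1)[of x] by (simp add: abs_mult ennreal_mult)
    qed
    have "(ennreal ?E)\<^sup>2 = (\<integral>\<^sup>+x. ennreal \<bar>1 - sqrt (r x)\<bar> * ennreal (1 + sqrt (r x)) \<partial>M)\<^sup>2"
      using iab by (simp add: nn_integral_eq_integral fac[symmetric])
    also have "\<dots> \<le> (\<integral>\<^sup>+x. ennreal ((1 - sqrt (r x))\<^sup>2) \<partial>M) * (\<integral>\<^sup>+x. ennreal ((1 + sqrt (r x))\<^sup>2) \<partial>M)"
      using Cauchy_Schwarz_nn_integral[of "\<lambda>x. ennreal \<bar>1 - sqrt (r x)\<bar>" M "\<lambda>x. ennreal (1 + sqrt (r x))"] r(1)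
      by (simp add: ennreal_power del: ennreal_plus)
    also have "\<dots> = ennreal (2 - 2 * ?B) * ennreal (2 + 2 * ?B)"
      using ip im by (simp add: nn_integral_eq_integral ep em del: ennreal_plus)
    finally have "ennreal (?E\<^sup>2) \<le> ennreal ((2 - 2 * ?B) * (2 + 2 * ?B))"
      by (simp add: ennreal_power ennreal_mult'[symmetric] ep[symmetric] ennreal_mult''[symmetric])
    moreover have "0 \<le> (2 - 2 * ?B) * (2 + 2 * ?B)"
      by (simp only: ep[symmetric] em[symmetric]) (simp add: Bochner_Integration.integral_nonneg)
    ultimately have "?E\<^sup>2 \<le> (2 - 2 * ?B) * (2 + 2 * ?B)" by simp
    also have "\<dots> = 4 * (1 - ?B\<^sup>2)" by (simp add: power2_eq_square algebra_simps)
    finally have "(?E / 2)\<^sup>2 \<le> 1 - ?B\<^sup>2" by (simp add: power_divide)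
    then show ?thesis by (rule real_le_rsqrt)
  qed
  finally show ?thesis .
qed

section \<open>Randomly shifted Gaussian coordinates\<close>

text \<open>The likelihood ratio of N(m, \<sigma>^2) to N(0, \<sigma>^2) at x.\<close>
definition shift_ratio :: "real \<Rightarrow> real \<Rightarrow> real \<Rightarrow> real" where
  "shift_ratio \<sigma> m x = exp ((2 * m * x - m\<^sup>2) / (2 * \<sigma>\<^sup>2))"

lemma shift_ratio_measurable [measurable (raw)]:
  assumes [measurable]: "f \<in> borel_measurable M" "g \<in> borel_measurable M"
  shows "(\<lambda>x. shift_ratio \<sigma> (f x) (g x)) \<in> borel_measurable M"
  unfolding shift_ratio_def by simp

lemma normal_density_shift_ratio:
  "\<sigma> > 0 \<Longrightarrow> normal_density 0 \<sigma> (x - m) = shift_ratio \<sigma> m x * normal_density 0 \<sigma> x"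
  by (simp add: normal_density_def shift_ratio_def exp_add[symmetric] power2_eq_square field_simps)

text \<open>
  The shift m w depends on the other component only, so by Fubini's theorem the likelihood ratio of
  the randomly shifted pair is that of a Gaussian shift by the constant m w, for each w separately.
\<close>
lemma distr_random_shift:
  assumes "\<sigma> > 0" "prob_space R" and [measurable]: "m \<in> borel_measurable R"
  defines "P \<equiv> density lborel (normal_density 0 \<sigma>) \<Otimes>\<^sub>M R"
  shows "distr P P (\<lambda>(x, w). (x + m w, w)) = density P (\<lambda>(x, w). shift_ratio \<sigma> (m w) x)"
proof (rule measure_eqI)
  let ?G = "density lborel (normal_density 0 \<sigma>)"
  interpret R: prob_space R by fact
  interpret G: prob_space ?G by (rule prob_space_normal_density) fact
  interpret pair_sigma_finite ?G R by unfold_locales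
  have sP[measurable_cong]: "sets P = sets (borel \<Otimes>\<^sub>M R)" unfolding P_def by (intro sets_pair_measure_cong) auto
  have T[measurable]: "(\<lambda>(x, w). (x + m w, w)) \<in> P \<rightarrow>\<^sub>M P" by measurable
  fix A assume "A \<in> sets (distr P P (\<lambda>(x, w). (x + m w, w)))"
  then have A[measurable]: "A \<in> sets (borel \<Otimes>\<^sub>M R)" using sP by simp
  have "emeasure (distr P P (\<lambda>(x, w). (x + m w, w))) A = (\<integral>\<^sup>+z. indicator A (fst z + m (snd z), snd z) \<partial>P)"
  proof (subst nn_integral_indicator[symmetric])
    show "A \<in> sets (distr P P (\<lambda>(x, w). (x + m w, w)))" using sP by simp
  qed (subst nn_integral_distr[OF T], auto simp: case_prod_unfold)
  also have "\<dots> = (\<integral>\<^sup>+w. \<integral>\<^sup>+x. indicator A (x + m w, w) \<partial>?G \<partial>R)"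
    unfolding P_def by (subst nn_integral_snd[symmetric]) (auto simp: case_prod_unfold)
  also have "\<dots> = (\<integral>\<^sup>+w. \<integral>\<^sup>+x. ennreal (shift_ratio \<sigma> (m w) x) * indicator A (x, w) \<partial>?G \<partial>R)"
  proof (rule nn_integral_cong)
    fix w assume [simp]: "w \<in> space R"
    have "(\<integral>\<^sup>+x. indicator A (x + m w, w) \<partial>?G) = (\<integral>\<^sup>+x. ennreal (normal_density 0 \<sigma> x) * indicator A (x + m w, w) \<partial>lborel)"
      by (subst nn_integral_density) auto
    also have "\<dots> = (\<integral>\<^sup>+x. ennreal (normal_density 0 \<sigma> (x - m w)) * indicator A (x, w) \<partial>lborel)"
      by (subst nn_integral_real_affine[of _ 1 "- m w"]) auto
    also have "\<dots> = (\<integral>\<^sup>+x. ennreal (shift_ratio \<sigma> (m w) x) * indicator A (x, w) \<partial>?G)"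
      using \<open>\<sigma> > 0\<close> by (subst nn_integral_density) (auto simp: normal_density_shift_ratio ennreal_mult' mult_ac)
    finally show "(\<integral>\<^sup>+x. indicator A (x + m w, w) \<partial>?G) = (\<integral>\<^sup>+x. ennreal (shift_ratio \<sigma> (m w) x) * indicator A (x, w) \<partial>?G)" .
  qed
  also have "\<dots> = (\<integral>\<^sup>+z. ennreal (shift_ratio \<sigma> (m (snd z)) (fst z)) * indicator A z \<partial>P)"
    unfolding P_def by (subst nn_integral_snd[symmetric]) (auto simp: case_prod_unfold)
  also have "\<dots> = emeasure (density P (\<lambda>(x, w). shift_ratio \<sigma> (m w) x)) A"
    using A sP by (subst emeasure_density) (auto simp: case_prod_unfold)
  finally show "emeasure (distr P P (\<lambda>(x, w). (x + m w, w))) A = emeasure (density P (\<lambda>(x, w). shift_ratio \<sigma> (m w) x)) A" .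
qed simp

text \<open>
  Completing the square: the geometric mean of the densities of N(0, \<sigma>^2) and N(m, \<sigma>^2) is a multiple
  of the density of N(m / 2, \<sigma>^2).
\<close>
lemma normal_affinity_shift:
  assumes "\<sigma> > 0"
  shows "(\<integral>\<^sup>+x. sqrt (shift_ratio \<sigma> m x) \<partial>density lborel (normal_density 0 \<sigma>)) = ennreal (exp (- (m\<^sup>2 / (8 * \<sigma>\<^sup>2))))"
proof -
  have eq: "normal_density 0 \<sigma> x * sqrt (shift_ratio \<sigma> m x) = exp (- (m\<^sup>2 / (8 * \<sigma>\<^sup>2))) * normal_density (m / 2) \<sigma> x" for x
  proof -
    have "sqrt (shift_ratio \<sigma> m x) = exp ((2 * m * x - m\<^sup>2) / (4 * \<sigma>\<^sup>2))"
      by (rule real_sqrt_unique) (simp_all add: shift_ratio_def exp_double[symmetric] diff_divide_distrib)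
    then show ?thesis
      using assms by (simp add: normal_density_def exp_add[symmetric] power2_eq_square field_simps)
  qed
  have "(\<integral>\<^sup>+x. sqrt (shift_ratio \<sigma> m x) \<partial>density lborel (normal_density 0 \<sigma>))
      = (\<integral>\<^sup>+x. ennreal (exp (- (m\<^sup>2 / (8 * \<sigma>\<^sup>2)))) * ennreal (normal_density (m / 2) \<sigma> x) \<partial>lborel)"
    by (subst nn_integral_density) (auto simp: ennreal_mult'[symmetric] eq)
  also have "\<dots> = ennreal (exp (- (m\<^sup>2 / (8 * \<sigma>\<^sup>2))))"
    using assms by (simp add: nn_integral_cmult nn_integral_eq_integral)
  finally show ?thesis .
qed

text \<open>
  Multiplied by the density of N(0, s^2), the integrand is 1 / q times the density of N(0, (s / q)^2), where q^2 = 1 + 2 k s^2.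
\<close>
lemma nn_integral_normal_exp_square:
  assumes "s > 0" "k \<ge> 0"
  shows "(\<integral>\<^sup>+x. exp (- (k * x\<^sup>2)) \<partial>density lborel (normal_density 0 s)) = ennreal (1 / sqrt (1 + 2 * k * s\<^sup>2))"
proof -
  define q where "q = sqrt (1 + 2 * k * s\<^sup>2)"
  have q: "q > 0" "q\<^sup>2 = 1 + 2 * k * s\<^sup>2" unfolding q_def using assms by (auto intro!: add_pos_nonneg)
  have eq: "normal_density 0 s x * exp (- (k * x\<^sup>2)) = 1 / q * normal_density 0 (s / q) x" for x
  proof -
    have "- (x\<^sup>2 / (2 * s\<^sup>2)) - k * x\<^sup>2 = - (x\<^sup>2 * q\<^sup>2 / (2 * s\<^sup>2))" using assms by (simp add: q(2) field_simps)
    moreover have "sqrt (2 * pi * (s / q)\<^sup>2) = sqrt (2 * pi * s\<^sup>2) / q"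
      using q(1) by (simp add: power_divide real_sqrt_divide)
    ultimately show ?thesis using q(1) assms
      by (simp add: normal_density_def exp_add[symmetric] power_divide)
  qed
  have "(\<integral>\<^sup>+x. exp (- (k * x\<^sup>2)) \<partial>density lborel (normal_density 0 s)) = (\<integral>\<^sup>+x. ennreal (1 / q) * ennreal (normal_density 0 (s / q) x) \<partial>lborel)"
    using q(1) by (subst nn_integral_density) (auto simp: ennreal_mult'[symmetric] eq)
  also have "\<dots> = ennreal (1 / q)"
    using assms q(1) by (simp add: nn_integral_cmult nn_integral_eq_integral)
  finally show ?thesis by (simp add: q_def)
qed

text \<open>
  Given w, the shift is m = b (S w) and contributes exp (- m^2 / (8 \<sigma>^2)) to the Bhattacharyya
  coefficient. Averaging over the Gaussian law of S gives B^2 = 1 / (1 + b^2 s^2 / (4 \<sigma>^2)). The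
  absolute value comes from applying the one-sided bound to both \<psi> and 1 - \<psi>.
\<close>
lemma random_shift_test_gap:
  assumes "\<sigma> > 0" "s > 0" "prob_space R" and S: "distributed R lborel S (normal_density 0 s)"
  defines "P \<equiv> density lborel (normal_density 0 \<sigma>) \<Otimes>\<^sub>M R"
  assumes [measurable]: "\<psi> \<in> borel_measurable P" and \<psi>: "\<And>z. z \<in> space P \<Longrightarrow> 0 \<le> \<psi> z \<and> \<psi> z \<le> (1::real)"
  shows "\<bar>(\<integral>z. \<psi> (fst z + b * S (snd z), snd z) \<partial>P) - (\<integral>z. \<psi> z \<partial>P)\<bar> \<le> sqrt (1 - 1 / (1 + b\<^sup>2 * s\<^sup>2 / (4 * \<sigma>\<^sup>2)))"
proof -
  let ?G = "density lborel (normal_density 0 \<sigma>)"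
  let ?r = "\<lambda>(x, w). shift_ratio \<sigma> (b * S w) x"
  let ?T = "\<lambda>(x, w). (x + b * S w, w)"
  interpret R: prob_space R by fact
  interpret G: prob_space ?G by (rule prob_space_normal_density) fact
  interpret P: pair_prob_space ?G R by unfold_locales
  have pP: "prob_space P" unfolding P_def by unfold_locales
  then interpret PP: prob_space P .
  have sP[measurable_cong]: "sets P = sets (borel \<Otimes>\<^sub>M R)" unfolding P_def by (intro sets_pair_measure_cong) auto
  have S_meas[measurable]: "S \<in> borel_measurable R" using S by (simp add: distributed_def)
  have r[measurable]: "?r \<in> borel_measurable P" and T[measurable]: "?T \<in> P \<rightarrow>\<^sub>M P" by measurable
  have r0: "0 \<le> ?r z" for z by (simp add: shift_ratio_def case_prod_unfold)
  have D: "distr P P ?T = density P ?r"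
    unfolding P_def using distr_random_shift[OF assms(1,3), of "\<lambda>w. b * S w"] by simp
  have "(\<integral>\<^sup>+z. ?r z \<partial>P) = emeasure (density P ?r) (space P)"
    by (subst emeasure_density) (auto intro!: nn_integral_cong)
  also have "\<dots> = 1" unfolding D[symmetric]
    using prob_space.emeasure_space_1[OF PP.prob_space_distr[OF T]] by simp
  finally have nr: "(\<integral>\<^sup>+z. ?r z \<partial>P) = 1" .
  have ir: "integrable P ?r" by (rule integrableI_nonneg) (use r0 nr in \<open>auto\<close>)
  have er: "(\<integral>z. ?r z \<partial>P) = 1" using r0 nr by (subst integral_eq_nn_integral) auto
  have shift: "(\<integral>z. f (fst z + b * S (snd z), snd z) \<partial>P) = (\<integral>z. ?r z * f z \<partial>P)"
    if [measurable]: "f \<in> borel_measurable P" for f :: "real \<times> _ \<Rightarrow> real"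
  proof -
    have "(\<integral>z. f (fst z + b * S (snd z), snd z) \<partial>P) = (\<integral>z. f z \<partial>distr P P ?T)"
      by (subst integral_distr) (auto simp: case_prod_unfold)
    also have "\<dots> = (\<integral>z. ?r z * f z \<partial>P)"
      unfolding D using r0 by (subst integral_real_density) auto
    finally show ?thesis .
  qed
  have "(\<integral>\<^sup>+z. sqrt (?r z) \<partial>P) = (\<integral>\<^sup>+w. \<integral>\<^sup>+x. sqrt (shift_ratio \<sigma> (b * S w) x) \<partial>?G \<partial>R)"
    unfolding P_def by (subst P.nn_integral_snd[symmetric]) (auto simp: case_prod_unfold)
  also have "\<dots> = (\<integral>\<^sup>+w. exp (- (b\<^sup>2 / (8 * \<sigma>\<^sup>2) * (S w)\<^sup>2)) \<partial>R)"
    using assms(1) by (simp add: normal_affinity_shift power_mult_distrib)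
  also have "\<dots> = (\<integral>\<^sup>+x. exp (- (b\<^sup>2 / (8 * \<sigma>\<^sup>2) * x\<^sup>2)) \<partial>distr R lborel S)"
    by (subst nn_integral_distr) auto
  also have "distr R lborel S = density lborel (normal_density 0 s)"
    using S by (simp add: distributed_def)
  also have "(\<integral>\<^sup>+x. exp (- (b\<^sup>2 / (8 * \<sigma>\<^sup>2) * x\<^sup>2)) \<partial>\<dots>) = ennreal (1 / sqrt (1 + 2 * (b\<^sup>2 / (8 * \<sigma>\<^sup>2)) * s\<^sup>2))"
    using assms(1,2) by (intro nn_integral_normal_exp_square) auto
  finally have nB: "(\<integral>\<^sup>+z. sqrt (?r z) \<partial>P) = ennreal (1 / sqrt (1 + b\<^sup>2 * s\<^sup>2 / (4 * \<sigma>\<^sup>2)))"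
    by (simp add: field_simps)
  have B: "(\<integral>z. sqrt (?r z) \<partial>P) = 1 / sqrt (1 + b\<^sup>2 * s\<^sup>2 / (4 * \<sigma>\<^sup>2))"
    using r0 nB by (subst integral_eq_nn_integral) auto
  have gap: "(\<integral>z. f z \<partial>P) - (\<integral>z. f (fst z + b * S (snd z), snd z) \<partial>P) \<le> sqrt (1 - 1 / (1 + b\<^sup>2 * s\<^sup>2 / (4 * \<sigma>\<^sup>2)))"
    if "f \<in> borel_measurable P" "\<And>z. z \<in> space P \<Longrightarrow> 0 \<le> f z \<and> f z \<le> (1::real)" for f
    using PP.test_gap_le_hellinger[OF r that(1) r0 ir er that(2)] shift[OF that(1)] B assms(1)
    by (simp add: power_divide add_nonneg_nonneg)
  have sp: "(fst z + b * S (snd z), snd z) \<in> space P" if "z \<in> space P" for z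
    using measurable_space[OF T that] by (simp add: case_prod_unfold)
  have i1: "integrable P \<psi>"
    by (rule PP.integrable_const_bound[of _ 1]) (use \<psi> in auto)
  have "(\<lambda>z. \<psi> (?T z)) \<in> borel_measurable P" by measurable
  then have i2: "integrable P (\<lambda>z. \<psi> (fst z + b * S (snd z), snd z))"
    by (intro PP.integrable_const_bound[of _ 1]) (use \<psi> sp in \<open>auto simp: case_prod_unfold\<close>)
  show ?thesis
    using gap[of \<psi>] gap[of "\<lambda>z. 1 - \<psi> z"] \<psi> i1 i2 by (auto simp: PP.prob_space abs_le_iff)
qed

section \<open>Autoregressive paths as functions of the innovations\<close>

text \<open>
  The coordinate w 1 is the initial state and w n, for n at least 2, is the noise driving sample n.
  The value 0 at time 0 is a convention that makes the recursion produce w 1 at time 1 for every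
  set of action times.
\<close>
fun ar1_path :: "real \<Rightarrow> nat set \<Rightarrow> (nat \<Rightarrow> real) \<Rightarrow> nat \<Rightarrow> real" where
  "ar1_path a C w 0 = 0"
| "ar1_path a C w (Suc n) = (if n \<in> C then 0 else a * ar1_path a C w n) + w (Suc n)"

definition innovation_law :: "real \<Rightarrow> real \<Rightarrow> nat \<Rightarrow> real measure" where
  "innovation_law a \<sigma> n = density lborel (normal_density 0 (if n = 1 then \<sigma> / sqrt (1 - a\<^sup>2) else \<sigma>))"

lemma ar1_path_cong:
  "(\<And>i. 1 \<le> i \<Longrightarrow> i \<le> n \<Longrightarrow> w i = w' i) \<Longrightarrow> ar1_path a C w n = ar1_path a C w' n"
  by (induction n) auto

text \<open>
  The summand removed by the reset at time t is put back into the innovation at time t + 1; at all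
  other times the two recursions coincide.
\<close>
lemma ar1_path_reset_eq_shift:
  "ar1_path a {} w n = ar1_path a {t} (w(Suc t := w (Suc t) + a * ar1_path a {} w t)) n"
  by (induction n) auto

lemma ar1_path_measurable:
  assumes "{1..n} \<subseteq> I"
  shows "(\<lambda>w. ar1_path a C w n) \<in> borel_measurable (PiM I (\<lambda>_. borel))"
  using assms
proof (induction n)
  case (Suc n)
  then have [measurable]: "(\<lambda>w. ar1_path a C w n) \<in> borel_measurable (PiM I (\<lambda>_. borel))" by (auto simp: subset_iff)
  have [measurable]: "(\<lambda>w. w (Suc n)) \<in> borel_measurable (PiM I (\<lambda>_. borel))"
    by (rule measurable_component_singleton) (use Suc.prems in auto)
  show ?case by simp
qed simp

definition ar1_observation :: "real \<Rightarrow> nat set \<Rightarrow> nat \<Rightarrow> (nat \<Rightarrow> real) \<Rightarrow> nat \<Rightarrow> real" where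
  "ar1_observation a C N w = (\<lambda>n\<in>{1..N}. ar1_path a C w n)"

lemma sets_innovations [measurable_cong]:
  "sets (PiM I (innovation_law a \<sigma>)) = sets (PiM I (\<lambda>_. borel))"
  by (rule sets_PiM_cong) (auto simp: innovation_law_def)

lemma ar1_observation_measurable [measurable]:
  "ar1_observation a C N \<in> PiM {1..N} (\<lambda>_. borel) \<rightarrow>\<^sub>M obs_space N"
  unfolding ar1_observation_def [abs_def] obs_space_def
  by (intro measurable_restrict ar1_path_measurable) auto

context
  fixes a \<sigma> :: real
  assumes gain: "\<bar>a\<bar> < 1" and noise: "\<sigma> > 0"
begin

lemma gain_square: "a\<^sup>2 < 1"
  using gain by (simp add: abs_square_less_1)

lemma prob_space_innovation_law: "prob_space (innovation_law a \<sigma> n)"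
  unfolding innovation_law_def using noise gain_square by (intro prob_space_normal_density) auto

lemma prob_space_innovations: "prob_space (PiM I (innovation_law a \<sigma>))"
  by (intro prob_space_PiM prob_space_innovation_law)

lemma distr_innovation:
  assumes "i \<in> I"
  shows "distr (PiM I (innovation_law a \<sigma>)) borel (\<lambda>w. w i) = innovation_law a \<sigma> i"
proof -
  have "distr (PiM I (innovation_law a \<sigma>)) borel (\<lambda>w. w i) = distr (PiM I (innovation_law a \<sigma>)) (innovation_law a \<sigma> i) (\<lambda>w. w i)"
    by (rule distr_cong) (auto simp: innovation_law_def)
  also have "\<dots> = innovation_law a \<sigma> i"
    using assms by (intro distr_PiM_component prob_space_innovation_law)
  finally show ?thesis .
qed

lemma innovation_distributed:
  assumes "i \<in> I"
  shows "distributed (PiM I (innovation_law a \<sigma>)) lborel (\<lambda>w. w i)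
    (normal_density 0 (if i = 1 then \<sigma> / sqrt (1 - a\<^sup>2) else \<sigma>))"
proof -
  have "distr (PiM I (innovation_law a \<sigma>)) lborel (\<lambda>w. w i) = distr (PiM I (innovation_law a \<sigma>)) borel (\<lambda>w. w i)"
    by (rule distr_cong) auto
  moreover have "(\<lambda>w. w i) \<in> borel_measurable (PiM I (\<lambda>_. borel::real measure))"
    using assms by (rule measurable_component_singleton)
  ultimately show ?thesis
    using distr_innovation[OF assms] by (auto simp: distributed_def innovation_law_def cong: measurable_cong_sets)
qed

lemma indep_innovations:
  assumes "I \<noteq> {}"
  shows "prob_space.indep_vars (PiM I (innovation_law a \<sigma>)) (\<lambda>_. borel) (\<lambda>i w. w i) I"
proof -
  interpret prob_space "PiM I (innovation_law a \<sigma>)" by (rule prob_space_innovations)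
  have "distr (PiM I (innovation_law a \<sigma>)) (PiM I (\<lambda>_. borel)) (\<lambda>w. \<lambda>i\<in>I. w i)
      = distr (PiM I (innovation_law a \<sigma>)) (PiM I (innovation_law a \<sigma>)) (\<lambda>w. w)"
    by (rule distr_cong) (auto simp: sets_innovations space_PiM)
  also have "\<dots> = PiM I (innovation_law a \<sigma>)" by simp
  also have "\<dots> = (\<Pi>\<^sub>M i\<in>I. distr (PiM I (innovation_law a \<sigma>)) borel (\<lambda>w. w i))"
    by (rule PiM_cong) (simp_all add: distr_innovation)
  finally show ?thesis
    using assms by (subst indep_vars_iff_distr_eq_PiM') auto
qed

text \<open>
  The variance v = \<sigma>^2 / (1 - a^2) solves a^2 v + \<sigma>^2 = v, and the past is independent of the next
  innovation, so one step of the recursion reproduces the law N(0, v).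
\<close>
lemma ar1_path_stationary:
  assumes "1 \<le> n" "{1..n} \<subseteq> I"
  shows "distributed (PiM I (innovation_law a \<sigma>)) lborel (\<lambda>w. ar1_path a {} w n) (normal_density 0 (\<sigma> / sqrt (1 - a\<^sup>2)))"
  using assms
proof (induction n rule: nat_induct_at_least)
  case base
  then show ?case using innovation_distributed[of 1 I] by simp
next
  case (Suc n)
  let ?Q = "PiM I (innovation_law a \<sigma>)" and ?s = "\<sigma> / sqrt (1 - a\<^sup>2)"
  interpret prob_space ?Q by (rule prob_space_innovations)
  have noise': "distributed ?Q lborel (\<lambda>w. w (Suc n)) (normal_density 0 \<sigma>)"
    using innovation_distributed[of "Suc n" I] Suc by (auto simp: subset_iff)
  show ?case
  \<comment> \<open>The law of a X_n is degenerate for a = 0 and is then not given by a normal density.\<close>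
  proof (cases "a = 0")
    case True
    then show ?thesis using noise' by simp
  next
    case False
    have s: "?s > 0" using noise gain_square by simp
    have IH: "distributed ?Q lborel (\<lambda>w. ar1_path a {} w n) (normal_density 0 ?s)"
      using Suc by (auto simp: subset_iff)
    have "distributed ?Q lborel (\<lambda>w. 0 + a * ar1_path a {} w n) (normal_density (0 + a * 0) (\<bar>a\<bar> * ?s))"
      using normal_density_affine[OF IH s False] .
    then have past: "distributed ?Q lborel (\<lambda>w. a * ar1_path a {} w n) (normal_density 0 (\<bar>a\<bar> * ?s))"
      by simp
    have "indep_var (PiM {1..n} (\<lambda>_. borel)) (\<lambda>w. \<lambda>i\<in>{1..n}. w i) (PiM {Suc n} (\<lambda>_. borel)) (\<lambda>w. \<lambda>i\<in>{Suc n}. w i)"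
      using Suc by (intro indep_var_restrict[OF indep_innovations]) auto
    then have "indep_var borel ((\<lambda>w. a * ar1_path a {} w n) \<circ> (\<lambda>w. \<lambda>i\<in>{1..n}. w i)) borel ((\<lambda>w. w (Suc n)) \<circ> (\<lambda>w. \<lambda>i\<in>{Suc n}. w i))"
      by (rule indep_var_compose) (auto intro!: borel_measurable_times ar1_path_measurable)
    moreover have "ar1_path a {} (\<lambda>i\<in>{1..n}. w i) n = ar1_path a {} w n" for w
      by (rule ar1_path_cong) auto
    ultimately have indep: "indep_var borel (\<lambda>w. a * ar1_path a {} w n) borel (\<lambda>w. w (Suc n))"
      by (simp add: comp_def)
    have "(\<bar>a\<bar> * ?s)\<^sup>2 + \<sigma>\<^sup>2 = ?s\<^sup>2"
      using gain_square by (simp add: power_mult_distrib power_divide field_simps)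
    then have "sqrt ((\<bar>a\<bar> * ?s)\<^sup>2 + \<sigma>\<^sup>2) = ?s"
      using s by (intro real_sqrt_unique) auto
    then show ?thesis
      using add_indep_normal[OF indep mult_pos_pos[OF _ s] noise past noise'] False by simp
  qed
qed

text \<open>
  Almost surely the recursion determines the observations from the innovations, and the innovations
  have the product law. So the observation law does not depend on the underlying probability
  space, and the two hypotheses, realized on different spaces, become comparable.
\<close>
lemma obs_law_eq_innovations:
  assumes "steady_ar1 M a \<sigma> X Z (\<lambda>n \<omega>. reset_control a C (\<lambda>k. X k \<omega>) n)" and "N \<ge> 1"
  shows "obs_law M N X = distr (PiM {1..N} (innovation_law a \<sigma>)) (obs_space N) (ar1_observation a C N)"
proof -
  interpret steady_ar1 M a \<sigma> X Z "\<lambda>n \<omega>. reset_control a C (\<lambda>k. X k \<omega>) n" by fact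
  define W where "W i = (if i = 1 then X 1 else Z i)" for i
  have Wd: "distributed M lborel (W i) (normal_density 0 (if i = 1 then \<sigma> / sqrt (1 - a\<^sup>2) else \<sigma>))"
    if "i \<ge> 1" for i
    using initial noise[of i] that by (auto simp: W_def)
  have Wm: "W i \<in> borel_measurable M" if "i \<ge> 1" for i
    using Wd[OF that] by (simp add: distributed_def)
  have "distr M borel (W i) = innovation_law a \<sigma> i" if "i \<ge> 1" for i
  proof -
    have "distr M borel (W i) = distr M lborel (W i)" by (rule distr_cong) auto
    then show ?thesis using Wd[OF that] by (simp add: distributed_def innovation_law_def)
  qed
  moreover have "indep_vars (\<lambda>_. borel) W {1..N}"
    using indep_vars_subset[OF independent, of "{1..N}"] by (simp add: W_def [abs_def] atLeastAtMost_def)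
  moreover have "indep_vars (\<lambda>_. borel) W {1..N} \<longleftrightarrow> distr M (PiM {1..N} (\<lambda>_. borel)) (\<lambda>\<omega>. \<lambda>i\<in>{1..N}. W i \<omega>)
      = (\<Pi>\<^sub>M i\<in>{1..N}. distr M borel (W i))"
    using assms(2) Wm by (intro indep_vars_iff_distr_eq_PiM') auto
  moreover have "(\<Pi>\<^sub>M i\<in>{1..N}. distr M borel (W i)) = PiM {1..N} (innovation_law a \<sigma>)"
    by (rule PiM_cong) (use calculation(1) in auto)
  ultimately have WQ: "distr M (PiM {1..N} (\<lambda>_. borel)) (\<lambda>\<omega>. \<lambda>i\<in>{1..N}. W i \<omega>) = PiM {1..N} (innovation_law a \<sigma>)"
    by simp
  have Xm: "(\<lambda>\<omega>. \<lambda>n\<in>{1..N}. X n \<omega>) \<in> M \<rightarrow>\<^sub>M obs_space N"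
    unfolding obs_space_def using measurable_X by (intro measurable_restrict) auto
  have Wm': "(\<lambda>\<omega>. \<lambda>i\<in>{1..N}. W i \<omega>) \<in> M \<rightarrow>\<^sub>M PiM {1..N} (\<lambda>_. borel)"
    using Wm by (intro measurable_restrict) auto
  have "AE \<omega> in M. \<forall>n\<in>{2..}. X n \<omega> = a * X (n - 1) \<omega> + Z n \<omega> - reset_control a C (\<lambda>k. X k \<omega>) n"
    using evolution by (subst AE_ball_countable) auto
  then have "AE \<omega> in M. (\<lambda>n\<in>{1..N}. X n \<omega>) = ar1_observation a C N (\<lambda>i\<in>{1..N}. W i \<omega>)"
  proof eventually_elim
    case (elim \<omega>)
    have "X n \<omega> = ar1_path a C (\<lambda>i\<in>{1..N}. W i \<omega>) n" if "1 \<le> n" "n \<le> N" for n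
      using that
    proof (induction n rule: nat_induct_at_least)
      case base
      then show ?case by (simp add: W_def)
    next
      case (Suc n)
      then show ?case using elim[rule_format, of "Suc n"] by (auto simp: W_def reset_control_def)
    qed
    then show ?case by (auto simp: ar1_observation_def)
  qed
  then have "obs_law M N X = distr M (obs_space N) (\<lambda>\<omega>. ar1_observation a C N (\<lambda>i\<in>{1..N}. W i \<omega>))"
    unfolding obs_law_def
    by (rule distr_cong_AE[OF refl refl _ Xm measurable_compose[OF Wm' ar1_observation_measurable]])
  also have "\<dots> = distr (distr M (PiM {1..N} (\<lambda>_. borel)) (\<lambda>\<omega>. \<lambda>i\<in>{1..N}. W i \<omega>)) (obs_space N) (ar1_observation a C N)"
    by (subst distr_distr[OF ar1_observation_measurable Wm']) (simp add: comp_def)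
  finally show ?thesis by (simp only: WQ)
qed

text \<open>
  The innovation at time t + 1 is split off as an independent Gaussian coordinate. The uncontrolled
  path is the reset path with this coordinate shifted by a X_t, so the random shift bound applies
  with b = a and s^2 = \<sigma>^2 / (1 - a^2). A reset after the last observed sample, t = N, is invisible.
\<close>
lemma single_reset_test_gap:
  assumes t: "t \<in> {1..N}" and [measurable]: "\<phi> \<in> borel_measurable (obs_space N)"
    and \<phi>: "\<And>x. x \<in> space (obs_space N) \<Longrightarrow> 0 \<le> \<phi> x \<and> \<phi> x \<le> (1::real)"
  defines "Q \<equiv> PiM {1..N} (innovation_law a \<sigma>)"
  shows "\<bar>(\<integral>w. \<phi> (ar1_observation a {} N w) \<partial>Q) - (\<integral>w. \<phi> (ar1_observation a {t} N w) \<partial>Q)\<bar>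
    \<le> sqrt (a\<^sup>2 / (4 - 3 * a\<^sup>2))"
proof (cases "t = N")
  case True
  have "ar1_path a {} w n = ar1_path a {N} w n" if "n \<le> N" for w n
    using that by (induction n) auto
  then have "ar1_observation a {} N = ar1_observation a {t} N"
    using True by (auto simp: ar1_observation_def fun_eq_iff)
  then show ?thesis using gain_square by simp
next
  case False
  define n where "n = Suc t"
  define I where "I = {1..N} - {n}"
  have I: "insert n I = {1..N}" "n \<notin> I" "finite I" "{1..t} \<subseteq> I"
    using t False by (auto simp: I_def n_def)
  let ?L = "innovation_law a \<sigma>"
  let ?G = "density lborel (normal_density 0 \<sigma>)"
  let ?R = "PiM I ?L"
  let ?s = "\<sigma> / sqrt (1 - a\<^sup>2)"
  have G: "?L n = ?G" using t by (simp add: innovation_law_def n_def)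
  let ?\<psi> = "\<lambda>z. \<phi> (ar1_observation a {t} N ((snd z)(n := fst z)))"
  interpret R: prob_space ?R by (rule prob_space_innovations)
  have upd: "(\<lambda>(x, w). w(n := x)) \<in> ?G \<Otimes>\<^sub>M ?R \<rightarrow>\<^sub>M PiM {1..N} (\<lambda>_. borel)"
  proof -
    have "(\<lambda>(x, w). w(n := x)) \<in> borel \<Otimes>\<^sub>M PiM I (\<lambda>_. borel :: real measure) \<rightarrow>\<^sub>M PiM (insert n I) (\<lambda>_. borel)"
      by measurable
    moreover have "sets (?G \<Otimes>\<^sub>M ?R) = sets (borel \<Otimes>\<^sub>M PiM I (\<lambda>_. borel :: real measure))"
      by (intro sets_pair_measure_cong sets_innovations) simp
    ultimately show ?thesis unfolding I(1)
      by (subst measurable_cong_sets[OF _ refl])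
  qed
  have Q: "Q = distr (?G \<Otimes>\<^sub>M ?R) (PiM {1..N} (\<lambda>_. borel)) (\<lambda>(x, w). w(n := x))"
  proof -
    have "Q = distr (?L n \<Otimes>\<^sub>M ?R) (PiM (insert n I) ?L) (\<lambda>(x, w). w(n := x))"
      unfolding Q_def I(1)[symmetric] using I
      by (intro distr_pair_PiM_eq_PiM[symmetric] prob_space_innovation_law)
    also have "\<dots> = distr (?G \<Otimes>\<^sub>M ?R) (PiM {1..N} (\<lambda>_. borel)) (\<lambda>(x, w). w(n := x))"
      unfolding G I(1) by (rule distr_cong) (simp_all add: sets_innovations)
    finally show ?thesis .
  qed
  have obs: "(\<lambda>w. \<phi> (ar1_observation a C N w)) \<in> borel_measurable (PiM {1..N} (\<lambda>_. borel))" for C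
    by measurable
  have int: "(\<integral>w. \<phi> (ar1_observation a C N w) \<partial>Q) = (\<integral>z. \<phi> (ar1_observation a C N ((snd z)(n := fst z))) \<partial>(?G \<Otimes>\<^sub>M ?R))" for C
    unfolding Q by (subst integral_distr[OF upd obs]) (simp add: case_prod_unfold)
  have shift: "ar1_observation a {} N (w(n := x)) = ar1_observation a {t} N (w(n := x + a * ar1_path a {} w t))" for x w
  proof -
    have past: "ar1_path a {} (w(n := x)) t = ar1_path a {} w t"
      by (rule ar1_path_cong) (auto simp: n_def)
    have "ar1_path a {} (w(n := x)) k = ar1_path a {t} (w(n := x + a * ar1_path a {} w t)) k" for k
      using ar1_path_reset_eq_shift[of a "w(n := x)" k t] unfolding n_def[symmetric] past by simp
    then show ?thesis
      unfolding ar1_observation_def by (intro restrict_ext)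
  qed
  have "\<bar>(\<integral>z. ?\<psi> (fst z + a * ar1_path a {} (snd z) t, snd z) \<partial>(?G \<Otimes>\<^sub>M ?R)) - (\<integral>z. ?\<psi> z \<partial>(?G \<Otimes>\<^sub>M ?R))\<bar>
      \<le> sqrt (1 - 1 / (1 + a\<^sup>2 * ?s\<^sup>2 / (4 * \<sigma>\<^sup>2)))"
  proof (rule random_shift_test_gap[OF noise _ R.prob_space_axioms])
    show "?s > 0" using noise gain_square by simp
    show "distributed ?R lborel (\<lambda>w. ar1_path a {} w t) (normal_density 0 ?s)"
      using t I by (intro ar1_path_stationary) auto
    show "?\<psi> \<in> borel_measurable (?G \<Otimes>\<^sub>M ?R)"
      using measurable_compose[OF upd obs] by (simp add: case_prod_unfold)
    fix z assume "z \<in> space (?G \<Otimes>\<^sub>M ?R)"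
    then have "(snd z)(n := fst z) \<in> space (PiM {1..N} (\<lambda>_. borel :: real measure))"
      using measurable_space[OF upd] by (auto simp: case_prod_unfold)
    from measurable_space[OF ar1_observation_measurable this] show "0 \<le> ?\<psi> z \<and> ?\<psi> z \<le> 1"
      by (rule \<phi>)
  qed
  moreover have "1 - 1 / (1 + a\<^sup>2 * ?s\<^sup>2 / (4 * \<sigma>\<^sup>2)) = a\<^sup>2 / (4 - 3 * a\<^sup>2)"
  proof -
    have eq: "1 + a\<^sup>2 * ?s\<^sup>2 / (4 * \<sigma>\<^sup>2) = (4 - 3 * a\<^sup>2) / (4 * (1 - a\<^sup>2))"
      using noise gain_square by (simp add: power_divide field_simps)
    show ?thesis unfolding eq using gain_square by (simp add: field_simps)
  qed
  ultimately show ?thesis by (simp add: int shift)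
qed

end

section \<open>Averaging over the time of the control action\<close>

lemma (in prob_space) integral_uniform_measure:
  fixes f :: "'a \<Rightarrow> real"
  assumes A: "A \<in> events" "prob A > 0" and f: "f \<in> borel_measurable M"
  shows "prob A * (\<integral>x. f x \<partial>uniform_measure M A) = expectation (\<lambda>x. indicator A x * f x)"
proof -
  have "uniform_measure M A = density M (\<lambda>x. ennreal (indicator A x / prob A))"
    unfolding uniform_measure_def using A(2)
    by (intro arg_cong[where f = "density M"] ext)
       (simp add: emeasure_eq_measure divide_ennreal ennreal_indicator[symmetric])
  then have "(\<integral>x. f x \<partial>uniform_measure M A) = expectation (\<lambda>x. indicator A x / prob A * f x)"
    using A f by (simp add: integral_real_density)
  then show ?thesis using A(2) by simp
qed

lemma (in prob_space) expectation_le_if_conditional_le: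
  fixes f :: "'a \<Rightarrow> real" and \<tau> :: "'a \<Rightarrow> 'b"
  assumes [measurable]: "\<tau> \<in> M \<rightarrow>\<^sub>M count_space UNIV" and T: "finite T" "AE \<omega> in M. \<tau> \<omega> \<in> T"
    and f: "integrable M f"
    and le: "\<And>t. t \<in> T \<Longrightarrow> prob {\<omega> \<in> space M. \<tau> \<omega> = t} > 0 \<Longrightarrow>
      (\<integral>x. f x \<partial>uniform_measure M {\<omega> \<in> space M. \<tau> \<omega> = t}) \<le> c"
  shows "expectation f \<le> c"
proof -
  let ?A = "\<lambda>t. {\<omega> \<in> space M. \<tau> \<omega> = t}"
  have ev: "?A t \<in> events" for t by measurable
  have total: "expectation g = (\<Sum>t\<in>T. expectation (\<lambda>\<omega>. indicator (?A t) \<omega> * g \<omega>))"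
    if g: "integrable M g" for g :: "'a \<Rightarrow> real"
  proof -
    have "expectation g = expectation (\<lambda>\<omega>. \<Sum>t\<in>T. indicator (?A t) \<omega> * g \<omega>)"
    proof (rule integral_cong_AE)
      show "AE \<omega> in M. g \<omega> = (\<Sum>t\<in>T. indicator (?A t) \<omega> * g \<omega>)"
        using T(2) AE_space
        by eventually_elim (use T(1) in \<open>simp add: sum_distrib_right[symmetric] indicator_def\<close>)
    qed (use g in measurable)
    also have "\<dots> = (\<Sum>t\<in>T. expectation (\<lambda>\<omega>. indicator (?A t) \<omega> * g \<omega>))"
      using integrable_real_mult_indicator[OF ev g] by (intro Bochner_Integration.integral_sum) (simp add: mult.commute)
    finally show ?thesis .
  qed
  have "expectation (\<lambda>\<omega>. indicator (?A t) \<omega> * f \<omega>) \<le> expectation (\<lambda>\<omega>. indicator (?A t) \<omega> * c)" if "t \<in> T" for t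
  proof (cases "prob (?A t) > 0")
    case True
    then show ?thesis
      using integral_uniform_measure[OF ev True, of f] f le[OF that True] ev
      by (simp flip: integral_uniform_measure)
  next
    case False
    then have "AE \<omega> in M. \<omega> \<notin> ?A t"
      using ev[of t] by (intro AE_not_in) (simp add: null_sets_def emeasure_eq_measure zero_less_measure_iff)
    then have "AE \<omega> in M. indicator (?A t) \<omega> * f \<omega> = 0" by eventually_elim simp
    then have "expectation (\<lambda>\<omega>. indicator (?A t) \<omega> * f \<omega>) = 0"
      by (rule integral_eq_zero_AE)
    then show ?thesis using False ev by (simp add: zero_less_measure_iff)
  qed
  then have "expectation f \<le> expectation (\<lambda>_. c)"
    unfolding total[OF f] total[OF integrable_const[of c]] by (rule sum_mono)
  then show ?thesis by (simp add: prob_space)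
qed

section \<open>Detectors as test functions\<close>

text \<open>The test function is the probability of deciding H1, given the observations.\<close>
lemma detection_error_sum:
  assumes "detector N \<delta>"
  obtains \<phi> where "\<phi> \<in> borel_measurable (obs_space N)"
    and "\<And>x. x \<in> space (obs_space N) \<Longrightarrow> 0 \<le> \<phi> x \<and> \<phi> x \<le> 1"
    and "\<And>P0 P1. \<lbrakk>prob_space P0; prob_space P1; sets P0 = sets (obs_space N); sets P1 = sets (obs_space N)\<rbrakk>
      \<Longrightarrow> false_alarm P0 \<delta> + miss_detection P1 \<delta> = 1 + (\<integral>x. \<phi> x \<partial>P0) - (\<integral>x. \<phi> x \<partial>P1)"
proof
  let ?\<phi> = "\<lambda>x. measure (\<delta> x) {H1}"
  have \<delta>: "\<delta> \<in> obs_space N \<rightarrow>\<^sub>M prob_algebra (count_space UNIV)"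
    using assms by (simp add: detector_def)
  show \<phi>m: "?\<phi> \<in> borel_measurable (obs_space N)"
    by (rule measurable_compose[OF \<delta> measurable_measure_prob_algebra]) simp
  have prob\<delta>: "prob_space (\<delta> x)" "sets (\<delta> x) = UNIV" if "x \<in> space (obs_space N)" for x
    using measurable_space[OF \<delta> that] by (auto simp: space_prob_algebra)
  show \<phi>01: "0 \<le> ?\<phi> x \<and> ?\<phi> x \<le> 1" if "x \<in> space (obs_space N)" for x
    using prob_space.prob_le_1[OF prob\<delta>(1)[OF that]] by simp
  have \<phi>0: "measure (\<delta> x) {H0} = 1 - ?\<phi> x" if "x \<in> space (obs_space N)" for x
  proof -
    interpret prob_space "\<delta> x" using prob\<delta>(1)[OF that] .
    have "space (\<delta> x) = UNIV"
      using sets_eq_imp_space_eq[of "\<delta> x" "count_space UNIV"] prob\<delta>(2)[OF that] by simp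
    moreover have "UNIV - {H1} = {H0}" using hypothesis.exhaust by auto
    ultimately show ?thesis
      using prob_compl[of "{H1}"] prob\<delta>(2)[OF that] by simp
  qed
  fix P0 P1 :: "(nat \<Rightarrow> real) measure"
  assume "prob_space P0" "prob_space P1"
    and s0: "sets P0 = sets (obs_space N)" and s1: "sets P1 = sets (obs_space N)"
  interpret P0: prob_space P0 by fact
  interpret P1: prob_space P1 by fact
  have \<delta>P: "\<delta> \<in> P \<rightarrow>\<^sub>M subprob_algebra (count_space UNIV)" if "sets P = sets (obs_space N)" for P
    using measurable_prob_algebraD[OF \<delta>] by (simp add: measurable_cong_sets[OF that refl])
  have sp1: "space P1 = space (obs_space N)" using s1 by (rule sets_eq_imp_space_eq)
  have fa: "false_alarm P0 \<delta> = (\<integral>x. ?\<phi> x \<partial>P0)"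
    unfolding false_alarm_def by (subst P0.measure_bind[OF \<delta>P[OF s0]]) simp_all
  have "?\<phi> \<in> borel_measurable P1"
    using \<phi>m by (simp add: measurable_cong_sets[OF s1 refl])
  then have int1: "integrable P1 ?\<phi>"
    by (intro P1.integrable_const_bound[of _ 1]) (use \<phi>01 sp1 in auto)
  have "miss_detection P1 \<delta> = (\<integral>x. measure (\<delta> x) {H0} \<partial>P1)"
    unfolding miss_detection_def by (subst P1.measure_bind[OF \<delta>P[OF s1]]) simp_all
  also have "\<dots> = (\<integral>x. 1 - ?\<phi> x \<partial>P1)"
    by (rule Bochner_Integration.integral_cong) (simp_all add: \<phi>0 sp1)
  also have "\<dots> = 1 - (\<integral>x. ?\<phi> x \<partial>P1)"
    using int1 by (simp add: P1.prob_space)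
  finally show "false_alarm P0 \<delta> + miss_detection P1 \<delta> = 1 + (\<integral>x. ?\<phi> x \<partial>P0) - (\<integral>x. ?\<phi> x \<partial>P1)"
    by (simp add: fa)
qed

section \<open>Covertness of a single reset\<close>

text \<open>
  Some action time has positive probability, and conditioning on it changes neither the space nor
  the measurable sets.
\<close>
lemma single_reset_ar1_measurable:
  assumes "single_reset_ar1 M a \<sigma> N \<tau> X Z" "n \<ge> 1"
  shows "X n \<in> borel_measurable M"
proof -
  let ?A = "\<lambda>t. {\<omega> \<in> space M. \<tau> \<omega> = t}"
  have M: "prob_space M" and \<tau>[measurable]: "\<tau> \<in> M \<rightarrow>\<^sub>M count_space UNIV"
    and \<tau>N: "AE \<omega> in M. \<tau> \<omega> \<in> {1..N}"
    using assms(1) by (auto simp: single_reset_ar1_def)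
  interpret prob_space M by fact
  have "\<exists>t\<in>{1..N}. prob (?A t) > 0"
  proof (rule ccontr)
    assume "\<not> ?thesis"
    then have null: "?A t \<in> null_sets M" if "t \<in> {1..N}" for t
      using that by (auto simp: null_sets_def emeasure_eq_measure zero_less_measure_iff)
    have "AE \<omega> in M. \<forall>t\<in>{1..N}. \<omega> \<notin> ?A t"
      by (intro AE_finite_allI AE_not_in null) auto
    then have "AE \<omega> in M. False"
      using \<tau>N AE_space by eventually_elim auto
    then show False by simp
  qed
  then obtain t where "steady_ar1 (uniform_measure M (?A t)) a \<sigma> X Z (\<lambda>n \<omega>. reset_control a {t} (\<lambda>k. X k \<omega>) n)"
    using assms(1) by (auto simp: single_reset_ar1_def)
  from steady_ar1.measurable_X[OF this assms(2)] show ?thesis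
    by (auto cong: measurable_cong_sets)
qed

theorem theorem5:
  fixes M0 :: "'v measure" and M1 :: "'w measure"
    and a \<sigma> \<epsilon> :: real and N :: nat and \<tau> :: "'w \<Rightarrow> nat"
    and X0 Z0 :: "nat \<Rightarrow> 'v \<Rightarrow> real" and X1 Z1 :: "nat \<Rightarrow> 'w \<Rightarrow> real"
    and \<delta> :: "(nat \<Rightarrow> real) \<Rightarrow> hypothesis measure"
  assumes "\<sigma> > 0" and "\<bar>a\<bar> < 1" and "N \<ge> 1"
    and "uncontrolled_ar1 M0 a \<sigma> X0 Z0"
    and "single_reset_ar1 M1 a \<sigma> N \<tau> X1 Z1"
    and "\<epsilon> > 0" and "\<bar>a\<bar> \<le> sqrt (1 - 2 powr (- 4 * \<epsilon>\<^sup>2))"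
    and "detector N \<delta>"
  shows "covert \<epsilon> (obs_law M0 N X0) (obs_law M1 N X1) \<delta>"
proof -
  let ?A = "\<lambda>t. {\<omega> \<in> space M1. \<tau> \<omega> = t}" and ?o = "\<lambda>\<omega>. \<lambda>n\<in>{1..N}. X1 n \<omega>"
  let ?Q = "PiM {1..N} (innovation_law a \<sigma>)"
  have steady0: "steady_ar1 M0 a \<sigma> X0 Z0 (\<lambda>n \<omega>. reset_control a {} (\<lambda>k. X0 k \<omega>) n)"
    using assms(4) by (simp add: uncontrolled_ar1_def)
  have M1: "prob_space M1" and \<tau>: "\<tau> \<in> M1 \<rightarrow>\<^sub>M count_space UNIV" and \<tau>N: "AE \<omega> in M1. \<tau> \<omega> \<in> {1..N}"
    using assms(5) by (auto simp: single_reset_ar1_def)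
  have steady1: "steady_ar1 (uniform_measure M1 (?A t)) a \<sigma> X1 Z1 (\<lambda>n \<omega>. reset_control a {t} (\<lambda>k. X1 k \<omega>) n)"
    if "t \<in> {1..N}" "measure M1 (?A t) > 0" for t
    using assms(5) that by (auto simp: single_reset_ar1_def)
  interpret M1: prob_space M1 by fact
  have "prob_space M0" using steady0 by (simp add: steady_ar1_def)
  moreover have "(\<lambda>\<omega>. \<lambda>n\<in>{1..N}. X0 n \<omega>) \<in> M0 \<rightarrow>\<^sub>M obs_space N"
    unfolding obs_space_def using steady_ar1.measurable_X[OF steady0] by (intro measurable_restrict) auto
  ultimately have P0: "prob_space (obs_law M0 N X0)"
    unfolding obs_law_def by (rule prob_space.prob_space_distr)
  have o: "?o \<in> M1 \<rightarrow>\<^sub>M obs_space N"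
    unfolding obs_space_def using single_reset_ar1_measurable[OF assms(5)] by (intro measurable_restrict) auto
  then have P1: "prob_space (obs_law M1 N X1)"
    unfolding obs_law_def by (rule M1.prob_space_distr)
  obtain \<phi> where \<phi>m[measurable]: "\<phi> \<in> borel_measurable (obs_space N)"
    and \<phi>01: "\<And>x. x \<in> space (obs_space N) \<Longrightarrow> 0 \<le> \<phi> x \<and> \<phi> x \<le> 1"
    and err: "false_alarm (obs_law M0 N X0) \<delta> + miss_detection (obs_law M1 N X1) \<delta>
      = 1 + (\<integral>x. \<phi> x \<partial>obs_law M0 N X0) - (\<integral>x. \<phi> x \<partial>obs_law M1 N X1)"
    using detection_error_sum[OF assms(8)] P0 P1 by (metis obs_law_def sets_distr)
  have obs: "ar1_observation a C N \<in> ?Q \<rightarrow>\<^sub>M obs_space N" for C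
    using ar1_observation_measurable by (simp only: measurable_cong_sets[OF sets_innovations refl])
  have "(\<integral>x. \<phi> x \<partial>obs_law M1 N X1) = (\<integral>\<omega>. \<phi> (?o \<omega>) \<partial>M1)"
    unfolding obs_law_def by (rule integral_distr[OF o \<phi>m])
  also have "\<dots> \<le> (\<integral>x. \<phi> x \<partial>obs_law M0 N X0) + \<epsilon>"
  proof (rule M1.expectation_le_if_conditional_le[OF \<tau> _ \<tau>N])
    show "integrable M1 (\<lambda>\<omega>. \<phi> (?o \<omega>))"
      by (rule M1.integrable_const_bound[of _ 1])
        (use \<phi>01 measurable_space[OF o] measurable_compose[OF o \<phi>m] in auto)
    fix t assume t: "t \<in> {1..N}" "measure M1 (?A t) > 0"
    have "(\<integral>\<omega>. \<phi> (?o \<omega>) \<partial>uniform_measure M1 (?A t)) = (\<integral>x. \<phi> x \<partial>obs_law (uniform_measure M1 (?A t)) N X1)"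
      unfolding obs_law_def
      by (rule integral_distr[OF _ \<phi>m, symmetric]) (use o in \<open>simp cong: measurable_cong_sets\<close>)
    also have "\<dots> = (\<integral>w. \<phi> (ar1_observation a {t} N w) \<partial>?Q)"
      unfolding obs_law_eq_innovations[OF assms(2,1) steady1[OF t] assms(3)]
      by (rule integral_distr[OF obs \<phi>m])
    also have "\<dots> \<le> (\<integral>w. \<phi> (ar1_observation a {} N w) \<partial>?Q) + sqrt (a\<^sup>2 / (4 - 3 * a\<^sup>2))"
      using single_reset_test_gap[OF assms(2,1) t(1) \<phi>m \<phi>01] by linarith
    also have "(\<integral>w. \<phi> (ar1_observation a {} N w) \<partial>?Q) = (\<integral>x. \<phi> x \<partial>obs_law M0 N X0)"
      unfolding obs_law_eq_innovations[OF assms(2,1) steady0 assms(3)]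
      by (rule integral_distr[OF obs \<phi>m, symmetric])
    finally show "(\<integral>\<omega>. \<phi> (?o \<omega>) \<partial>uniform_measure M1 (?A t)) \<le> (\<integral>x. \<phi> x \<partial>obs_law M0 N X0) + \<epsilon>"
      using covert_gain_bound[OF assms(2,6,7)] by linarith
  qed simp
  finally show ?thesis
    by (simp add: covert_def err)
qed

end
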